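(* A finite nontrivial group $G$ is perfect if and only if no irreducible character of $G$ has codegree equal to a prime number.
   Context: For a finite group $G$ and a complex irreducible character $\chi\in\mathrm{Irr}(G)$, the codegree of $\chi$ is $\mathrm{cod}(\chi)=|G:\ker(\chi)|/\chi(1)$. A group is perfect if it equals its derived subgroup. *)

theory Defs
  imports
    "HOL-Algebra.Generated_Groups"
    "HOL-Computational_Algebra.Primes"
    "Jordan_Normal_Form.VS_Connect"
begin

definition GL :: "nat \<Rightarrow> complex mat monoid" where
  "GL n = units_of (ring_mat TYPE(complex) n ())"

definition representation ::
  "('a, 'b) monoid_scheme \<Rightarrow> nat \<Rightarrow> ('a \<Rightarrow> complex mat) \<Rightarrow> bool" where
  "representation G n \<rho> \<longleftrightarrow> \<rho> \<in> hom G (GL n)"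

definition invariant_subspace ::
  "('a, 'b) monoid_scheme \<Rightarrow> nat \<Rightarrow> ('a \<Rightarrow> complex mat) \<Rightarrow> complex vec set \<Rightarrow> bool" where
  "invariant_subspace G n \<rho> W \<longleftrightarrow>
     VectorSpace.subspace class_ring W (module_vec TYPE(complex) n) \<and>
     (\<forall>g\<in>carrier G. \<forall>w\<in>W. \<rho> g *\<^sub>v w \<in> W)"

text \<open>The zero representation is not irreducible, hence the condition \<open>0 < n\<close>.\<close>

definition irreducible_representation ::
  "('a, 'b) monoid_scheme \<Rightarrow> nat \<Rightarrow> ('a \<Rightarrow> complex mat) \<Rightarrow> bool" where
  "irreducible_representation G n \<rho> \<longleftrightarrow>
     representation G n \<rho> \<and> 0 < n \<and>
     (\<forall>W. invariant_subspace G n \<rho> W \<longrightarrow> W = {0\<^sub>v n} \<or> W = carrier_vec n)"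

definition mat_trace :: "'c :: comm_monoid_add mat \<Rightarrow> 'c" where
  "mat_trace A = (\<Sum>i<dim_row A. A $$ (i, i))"

text \<open>Characters are made extensional (undefined outside the carrier), so that \<open>Irr G\<close> contains
  one function for each irreducible character.\<close>

definition character_of ::
  "('a, 'b) monoid_scheme \<Rightarrow> ('a \<Rightarrow> complex mat) \<Rightarrow> 'a \<Rightarrow> complex" where
  "character_of G \<rho> = (\<lambda>g\<in>carrier G. mat_trace (\<rho> g))"

definition Irr :: "('a, 'b) monoid_scheme \<Rightarrow> ('a \<Rightarrow> complex) set" where
  "Irr G = {character_of G \<rho> | n \<rho>. irreducible_representation G n \<rho>}"

text \<open>The usual definition of the kernel of a character \<open>\<chi>\<close> of a finite group; it is the kernel
  of every complex representation affording \<open>\<chi>\<close>.\<close>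

definition char_ker :: "('a, 'b) monoid_scheme \<Rightarrow> ('a \<Rightarrow> complex) \<Rightarrow> 'a set" where
  "char_ker G \<chi> = {g \<in> carrier G. \<chi> g = \<chi> \<one>\<^bsub>G\<^esub>}"

definition cod :: "('a, 'b) monoid_scheme \<Rightarrow> ('a \<Rightarrow> complex) \<Rightarrow> complex" where
  "cod G \<chi> = of_nat (card (rcosets\<^bsub>G\<^esub> (char_ker G \<chi>))) / \<chi> \<one>\<^bsub>G\<^esub>"

definition perfect :: "('a, 'b) monoid_scheme \<Rightarrow> bool" where
  "perfect G \<longleftrightarrow> derived G (carrier G) = carrier G"

end

theory Submission
  imports
    Defs
    "HOL-Algebra.Sylow"
    "HOL-Algebra.Multiplicative_Group"
    "Jordan_Normal_Form.Schur_Decomposition"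
    "Jordan_Normal_Form.Spectral_Radius"
begin

text \<open>
  If \<open>G\<close> is not perfect, a maximal subgroup \<open>N\<close> containing the derived subgroup is normal of prime
  index \<open>p\<close>, and a faithful linear character of \<open>G/N\<close> has codegree \<open>p\<close>.

  Conversely let \<open>G\<close> be perfect and let \<open>\<chi>\<close> have degree \<open>n\<close>, kernel \<open>K\<close> and codegree \<open>p\<close>, so that
  \<open>H = G/K\<close> has order \<open>p n\<close>. Orthogonality gives \<open>n\<^sup>2 < p n\<close>, i.e. \<open>n < p\<close>. Hence \<open>H\<close> has only one
  subgroup of order \<open>p\<close>, which is central, since \<open>H\<close> is perfect and the automorphism group of a
  cyclic group is abelian. By Schur's lemma a generator acts as a scalar \<open>c\<close> with \<open>c\<^sup>p = 1\<close>, and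
  \<open>c\<^sup>n = 1\<close> because the determinant is trivial on a perfect group. As \<open>n < p\<close>, this forces \<open>c = 1\<close>,
  contradicting faithfulness.
\<close>

subsection \<open>Finite groups\<close>

lemma int_dvd_diff_iff_mod_eq:
  "int p dvd int i - int j \<longleftrightarrow> i mod p = j mod p"
  by (simp flip: mod_eq_dvd_iff zmod_int)

context group
begin

text \<open>Cauchy's theorem. Sylow's theorem is used with exponent 1, where the cofactor may still
  be divisible by \<open>p\<close>; every nontrivial element of the resulting subgroup of order
  \<open>p\<close> has order \<open>p\<close>.\<close>

lemma ex_element_of_prime_order:
  assumes "finite (carrier G)" "Factorial_Ring.prime p" "p dvd Coset.order G"
  shows "\<exists>x\<in>carrier G. ord x = p"
proof -
  obtain m where "Coset.order G = p ^ 1 * m"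
    using assms(3) by (auto elim: dvdE)
  then obtain P where P: "subgroup P G" "card P = p"
    using sylow_thm[OF assms(2) is_group _ assms(1)] by (metis power_one_right)
  have "2 \<le> card P"
    using P(2) assms(2) prime_ge_2_nat by blast
  then obtain x where x: "x \<in> P" "x \<noteq> \<one>"
  proof (cases "P \<subseteq> {\<one>}")
    case True
    then have "card P \<le> 1" using card_mono[OF _ True] by simp
    with \<open>2 \<le> card P\<close> show ?thesis by simp
  qed blast
  have xG: "x \<in> carrier G"
    using x P(1) subgroup.mem_carrier by metis
  have "x [^] p = \<one>"
  proof -
    interpret P: group "G\<lparr>carrier := P\<rparr>"
      by (rule subgroup_imp_group[OF P(1)])
    have "x [^]\<^bsub>G\<lparr>carrier := P\<rparr>\<^esub> Coset.order (G\<lparr>carrier := P\<rparr>) = \<one>"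
      using P.pow_order_eq_1[of x] x by simp
    then show ?thesis
      using nat_pow_consistent[of x p P] P(2) by (simp add: Coset.order_def)
  qed
  then have "ord x dvd p" "ord x \<noteq> 1"
    using xG x by (simp_all only: pow_eq_id ord_eq_1 not_False_eq_True)
  then have "ord x = p"
    using assms(2) by (metis prime_nat_iff)
  with xG show ?thesis by blast
qed

section \<open>Commutators and perfect groups\<close>

lemma derived_carrier_le:
  assumes "subgroup S G"
    and "\<And>g h. g \<in> carrier G \<Longrightarrow> h \<in> carrier G \<Longrightarrow> g \<otimes> h \<otimes> inv g \<otimes> inv h \<in> S"
  shows "derived G (carrier G) \<subseteq> S"
  unfolding derived_def by (rule generate_subgroup_incl[OF _ assms(1)]) (use assms(2) in auto)

text \<open>The conjugate of \<open>h\<close> by \<open>x\<close> is the commutator of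
  \<open>x\<close> and \<open>h\<close> times \<open>h\<close>, and both factors lie in
  \<open>N\<close>.\<close>

lemma derived_le_imp_normal:
  assumes "subgroup N G" "derived G (carrier G) \<subseteq> N"
  shows "N \<lhd> G"
proof (rule normal_invI[OF assms(1)])
  fix x h assume x: "x \<in> carrier G" and h: "h \<in> N"
  then have hG: "h \<in> carrier G"
    using assms(1) subgroup.mem_carrier by metis
  have "x \<otimes> h \<otimes> inv x \<otimes> inv h \<in> N"
    using assms(2) generate.incl[of _ "derived_set G (carrier G)" G] x hG
    unfolding derived_def by blast
  then have "x \<otimes> h \<otimes> inv x \<otimes> inv h \<otimes> h \<in> N"
    using assms(1) h subgroup.m_closed by metis
  then show "x \<otimes> h \<otimes> inv x \<in> N"
    using x hG by (simp add: m_assoc)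
qed

text \<open>Multiplication in a field commutes, so every commutator is sent to 1. Stating this for a
  bare multiplicative map lets it apply directly to the determinant of a representation.\<close>

lemma perfect_imp_trivial_character:
  fixes f :: "'a \<Rightarrow> 'c :: field"
  assumes "perfect G"
    and mult: "\<And>x y. x \<in> carrier G \<Longrightarrow> y \<in> carrier G \<Longrightarrow> f (x \<otimes> y) = f x * f y"
    and one: "f \<one> = 1" and g: "g \<in> carrier G"
  shows "f g = 1"
proof -
  let ?S = "{g \<in> carrier G. f g = 1}"
  have inv: "f x * f (inv x) = 1" if "x \<in> carrier G" for x
    using mult[of x "inv x"] that one by simp
  have S: "subgroup ?S G"
  proof (rule subgroupI)
    fix a assume "a \<in> ?S"
    then show "inv a \<in> ?S" using inv[of a] by simp
  qed (use mult one in auto)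
  have "derived G (carrier G) \<subseteq> ?S"
  proof (rule derived_carrier_le[OF S])
    fix x y assume xy: "x \<in> carrier G" "y \<in> carrier G"
    have "f (x \<otimes> y \<otimes> inv x \<otimes> inv y) = (f x * f (inv x)) * (f y * f (inv y))"
      using xy by (simp add: mult)
    then show "x \<otimes> y \<otimes> inv x \<otimes> inv y \<in> ?S"
      using xy by (simp add: inv)
  qed
  then show ?thesis using assms(1) g unfolding perfect_def by auto
qed

lemma conj_nat_pow:
  assumes "g \<in> carrier G" "x \<in> carrier G"
  shows "g \<otimes> (x [^] (n::nat)) \<otimes> inv g = (g \<otimes> x \<otimes> inv g) [^] n"
proof (induction n)
  case 0
  then show ?case using assms by simp
next
  case (Suc n)
  have "g \<otimes> (x [^] Suc n) \<otimes> inv g = (g \<otimes> (x [^] n) \<otimes> inv g) \<otimes> (g \<otimes> x \<otimes> inv g)"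
  proof -
    have "inv g \<otimes> (g \<otimes> (x \<otimes> inv g)) = x \<otimes> inv g"
      using assms by (simp flip: m_assoc)
    then show ?thesis using assms by (simp add: m_assoc)
  qed
  then show ?case using Suc by simp
qed

text \<open>The automorphisms of a cyclic group commute.\<close>

lemma perfect_imp_cyclic_normal_central:
  assumes "perfect G" and x: "x \<in> carrier G"
    and norm: "\<And>g. g \<in> carrier G \<Longrightarrow> \<exists>a::nat. g \<otimes> x \<otimes> inv g = x [^] a"
    and g: "g \<in> carrier G"
  shows "g \<otimes> x = x \<otimes> g"
proof -
  \<comment> \<open>Conjugation by \<open>g\<close> acts on the powers of \<open>x\<close> by
    multiplying exponents by \<open>e g\<close>.\<close>
  obtain e :: "'a \<Rightarrow> nat" where e: "g \<otimes> x \<otimes> inv g = x [^] e g" if "g \<in> carrier G" for g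
    using norm by metis
  have pow: "g \<otimes> (x [^] n) \<otimes> inv g = x [^] (e g * n)" if "g \<in> carrier G" for g and n :: nat
    using that x by (simp add: conj_nat_pow e nat_pow_pow)
  have conj_mult: "(g \<otimes> h) \<otimes> y \<otimes> inv (g \<otimes> h) = g \<otimes> (h \<otimes> y \<otimes> inv h) \<otimes> inv g"
    if "g \<in> carrier G" "h \<in> carrier G" "y \<in> carrier G" for g h y
    using that by (simp add: inv_mult_group m_assoc)
  \<comment> \<open>Exponents are determined only modulo the order of \<open>x\<close>, so the fact
    that \<open>e g\<close> and \<open>e (inv g)\<close> are mutually inverse is expressed through
    powers of \<open>x\<close>.\<close>
  have cancel: "x [^] (e g * e (inv g) * n) = x [^] n" if "g \<in> carrier G" for g and n :: nat
  proof -
    have "x [^] (e g * e (inv g) * n) = (g \<otimes> inv g) \<otimes> (x [^] n) \<otimes> inv (g \<otimes> inv g)"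
      using that x pow[of "inv g" n] by (subst conj_mult) (simp_all add: pow mult.assoc)
    then show ?thesis using that x by simp
  qed
  let ?S = "{g \<in> carrier G. g \<otimes> x \<otimes> inv g = x}"
  have S: "subgroup ?S G"
  proof (rule subgroupI)
    fix a assume a: "a \<in> ?S"
    then have "inv a \<otimes> (a \<otimes> x \<otimes> inv a) \<otimes> a = inv a \<otimes> x \<otimes> a" by simp
    moreover have "inv a \<otimes> (a \<otimes> x \<otimes> inv a) \<otimes> a = x"
    proof -
      have aG: "a \<in> carrier G" using a by simp
      have "inv a \<otimes> (a \<otimes> (x \<otimes> (inv a \<otimes> a))) = x"
        using aG x by (simp flip: m_assoc)
      then show ?thesis using aG x by (simp add: m_assoc)
    qed
    ultimately show "inv a \<in> ?S" using a by simp
  next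
    fix a b assume "a \<in> ?S" "b \<in> ?S"
    then show "a \<otimes> b \<in> ?S" using conj_mult[of a b x] x by simp
  qed (use x in auto)
  have "derived G (carrier G) \<subseteq> ?S"
  proof (rule derived_carrier_le[OF S])
    fix g h assume gh: "g \<in> carrier G" "h \<in> carrier G"
    have "g \<otimes> h \<otimes> inv g \<otimes> inv h \<otimes> x \<otimes> inv (g \<otimes> h \<otimes> inv g \<otimes> inv h)
        = g \<otimes> (h \<otimes> (inv g \<otimes> (inv h \<otimes> x \<otimes> inv (inv h)) \<otimes> inv (inv g)) \<otimes> inv h) \<otimes> inv g"
      using gh x by (simp only: conj_mult m_closed inv_closed)
    also have "\<dots> = x [^] (e g * (e h * (e (inv g) * e (inv h))))"
      using gh x by (simp only: e pow inv_closed)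
    \<comment> \<open>Exponents multiply commutatively, so each factor can be moved next to its
      inverse; this makes the commutator act trivially on \<open>x\<close>.\<close>
    also have "\<dots> = x [^] (e g * e (inv g) * (e h * e (inv h) * 1))"
      by (simp add: ac_simps)
    also have "\<dots> = x [^] (1 :: nat)"
      by (simp only: cancel gh)
    finally show "g \<otimes> h \<otimes> inv g \<otimes> inv h \<in> ?S"
      using gh x by simp
  qed
  then have "g \<otimes> x \<otimes> inv g = x"
    using assms(1) g unfolding perfect_def by auto
  then have "g \<otimes> x \<otimes> inv g \<otimes> g = x \<otimes> g" by simp
  then show ?thesis using g x by (simp add: m_assoc)
qed

text \<open>Two distinct subgroups of order \<open>p\<close> would have a product set of size \<open>p\<^sup>2\<close>.\<close>

lemma in_prime_order_cyclic_subgroup: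
  assumes "finite (carrier G)" "Factorial_Ring.prime p" "Coset.order G < p * p"
    and x: "x \<in> carrier G" "ord x = p" and y: "y \<in> carrier G" "ord y = p"
  shows "\<exists>a::nat. y = x [^] a"
proof -
  let ?f = "\<lambda>(i::nat, j::nat). x [^] i \<otimes> inv (y [^] j)"
  \<comment> \<open>Pigeonhole: there are \<open>p * p\<close> pairs of exponents but fewer group
    elements.\<close>
  have "\<not> inj_on ?f ({..<p} \<times> {..<p})"
  proof
    assume "inj_on ?f ({..<p} \<times> {..<p})"
    then have "card ({..<p} \<times> {..<p}) \<le> card (carrier G)"
      by (rule card_inj_on_le) (use x y assms(1) in auto)
    then show False using assms(3) by (simp add: Coset.order_def)
  qed
  then obtain i j k l where ijkl: "i < p" "j < p" "k < p" "l < p" "(i, j) \<noteq> (k, l)"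
    and eq: "x [^] i \<otimes> inv (y [^] j) = x [^] k \<otimes> inv (y [^] l)"
    unfolding inj_on_def by auto
  \<comment> \<open>A collision turns into an equality between a power of \<open>x\<close> and a
    power of \<open>y\<close>; integer exponents are needed because the differences may be
    negative.\<close>
  have eq': "x [^] (int i - int k) = y [^] (int j - int l)"
  proof -
    have "inv (x [^] k) \<otimes> (x [^] i \<otimes> inv (y [^] j)) \<otimes> y [^] j
      = inv (x [^] k) \<otimes> (x [^] k \<otimes> inv (y [^] l)) \<otimes> y [^] j"
      using eq by simp
    then have "inv (x [^] k) \<otimes> x [^] i = inv (y [^] l) \<otimes> y [^] j"
      using x y by (simp add: m_assoc) (simp flip: m_assoc)
    moreover have "x [^] (- int k + int i) = inv (x [^] k) \<otimes> x [^] i"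
      using x by (simp only: int_pow_mult int_pow_neg int_pow_int)
    moreover have "y [^] (- int l + int j) = inv (y [^] l) \<otimes> y [^] j"
      using y by (simp only: int_pow_mult int_pow_neg int_pow_int)
    ultimately show ?thesis by (simp add: algebra_simps)
  qed
  have jl: "j \<noteq> l"
  proof
    assume "j = l"
    then have "x [^] (int i - int k) = \<one>" using eq' by simp
    then have "int p dvd int i - int k" using x by (simp add: int_pow_eq_id)
    then have "i = k" using ijkl by (simp add: int_dvd_diff_iff_mod_eq)
    with \<open>j = l\<close> ijkl show False by simp
  qed
  have "\<not> int p dvd int j - int l"
    using ijkl jl by (simp add: int_dvd_diff_iff_mod_eq)
  then have "coprime (int j - int l) (int p)"
    using assms(2) by (metis coprime_commute prime_imp_coprime prime_nat_int_transfer)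
  \<comment> \<open>By Bezout, \<open>u\<close> inverts \<open>j - l\<close> modulo
    \<open>p\<close>, so raising \<open>eq'\<close> to the power \<open>u\<close> expresses
    \<open>y\<close> through \<open>x\<close>.\<close>
  then obtain u v where "u * (int j - int l) + v * int p = 1"
    using bezout_int[of "int j - int l" "int p"] by auto
  then have u: "(int j - int l) * u - 1 = int p * (- v)"
    by (simp add: algebra_simps)
  have "y [^] (1::int) = y [^] ((int j - int l) * u)"
    unfolding int_pow_eq[OF y(1)] y(2) u by simp
  then have "y = y [^] ((int j - int l) * u)"
    using y by simp
  also have "\<dots> = x [^] ((int i - int k) * u)"
    by (simp flip: int_pow_pow[OF x(1)] int_pow_pow[OF y(1)] add: eq')
  \<comment> \<open>Reducing the exponent modulo \<open>p\<close>, the order of \<open>x\<close>,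
    makes it a natural number.\<close>
  also have "\<dots> = x [^] nat (((int i - int k) * u) mod int p)"
  proof -
    have "p > 0" using assms(2) prime_gt_0_nat by blast
    then have "0 \<le> ((int i - int k) * u) mod int p" by simp
    then have "x [^] nat (((int i - int k) * u) mod int p) = x [^] (((int i - int k) * u) mod int p)"
      by (metis int_nat_eq int_pow_int)
    also have "\<dots> = x [^] ((int i - int k) * u)"
      using x by (simp add: int_pow_eq)
    finally show ?thesis by simp
  qed
  finally show ?thesis by blast
qed

text \<open>Conjugates of an element \<open>x\<close> of order \<open>p\<close> again have order
  \<open>p\<close>. Since the group has fewer than \<open>p * p\<close> elements, they are powers of
  \<open>x\<close>, and perfectness makes \<open>x\<close> central.\<close>

lemma perfect_imp_central_element:
  assumes "finite (carrier G)" "perfect G" "Factorial_Ring.prime p" "Coset.order G = p * n" "n < p"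
  shows "\<exists>x\<in>carrier G. ord x = p \<and> (\<forall>g\<in>carrier G. g \<otimes> x = x \<otimes> g)"
proof -
  obtain x where x: "x \<in> carrier G" "ord x = p"
    using ex_element_of_prime_order[OF assms(1,3)] assms(4) by auto
  have "Coset.order G < p * p" using assms(3,4,5) by simp
  moreover have "ord (g \<otimes> x \<otimes> inv g) = p" if "g \<in> carrier G" for g
  proof -
    have "(g \<otimes> x \<otimes> inv g) [^] n = \<one> \<longleftrightarrow> x [^] n = \<one>" for n :: nat
    proof
      assume "(g \<otimes> x \<otimes> inv g) [^] n = \<one>"
      then have "g \<otimes> x [^] n \<otimes> inv g = \<one>" using that x by (simp add: conj_nat_pow)
      then have "inv g \<otimes> (g \<otimes> x [^] n \<otimes> inv g) \<otimes> g = \<one>" using that by simp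
      moreover have "inv g \<otimes> (g \<otimes> (x [^] n \<otimes> (inv g \<otimes> g))) = x [^] n"
        using that x by (simp flip: m_assoc)
      ultimately show "x [^] n = \<one>" using that x by (simp add: m_assoc)
    qed (use that x in \<open>simp flip: conj_nat_pow\<close>)
    then show ?thesis using that x by (subst ord_unique) (simp_all add: pow_eq_id)
  qed
  ultimately have "\<exists>a::nat. g \<otimes> x \<otimes> inv g = x [^] a" if "g \<in> carrier G" for g
    using in_prime_order_cyclic_subgroup[OF assms(1,3) _ x] that x by simp
  then show ?thesis
    using perfect_imp_cyclic_normal_central[OF assms(2) x(1)] x by blast
qed

section \<open>Quotients of prime order and their characters\<close>

text \<open>Take \<open>N\<close> maximal among the proper subgroups containing the derived
  subgroup. The quotient has a subgroup \<open>P\<close> of prime order, whose preimage properly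
  contains \<open>N\<close> and therefore is all of \<open>G\<close>; so \<open>P\<close> is the
  whole quotient.\<close>

lemma ex_normal_subgroup_of_prime_index:
  assumes fin: "finite (carrier G)" and "\<not> perfect G"
  shows "\<exists>N. N \<lhd> G \<and> Factorial_Ring.prime (card (rcosets N))"
proof -
  let ?S = "{N. subgroup N G \<and> derived G (carrier G) \<subseteq> N \<and> N \<noteq> carrier G}"
  have "?S \<subseteq> Pow (carrier G)"
    using subgroup.subset by auto
  then have "finite ?S"
    by (rule finite_subset) (use fin in simp)
  \<comment> \<open>The family is nonempty precisely because the derived subgroup is proper.\<close>
  moreover have "derived G (carrier G) \<in> ?S"
    using assms(2) derived_is_subgroup[of "carrier G"] unfolding perfect_def by simp
  ultimately have "\<exists>N\<in>?S. \<forall>M\<in>?S. N \<subseteq> M \<longrightarrow> N = M"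
    by (intro finite_has_maximal) auto
  then obtain N where N: "N \<in> ?S" and max: "\<And>M. M \<in> ?S \<Longrightarrow> N \<subseteq> M \<Longrightarrow> N = M"
    by meson
  interpret N: normal N G
    using derived_le_imp_normal N by simp
  interpret F: group "G Mod N"
    by (rule N.factorgroup_is_group)
  have carF: "carrier (G Mod N) = rcosets N"
    by (simp add: FactGroup_def)
  have finF: "finite (carrier (G Mod N))"
    unfolding carF RCOSETS_def using fin by simp
  have "card (rcosets N) * card N = Coset.order G"
    by (rule lagrange[OF N.subgroup_axioms])
  moreover have "card N \<noteq> Coset.order G"
    using N card_subset_eq[OF fin N.subset] unfolding Coset.order_def by auto
  ultimately have "card (rcosets N) \<noteq> 1" by auto
  then obtain p where p: "Factorial_Ring.prime p" "p dvd Coset.order (G Mod N)"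
    unfolding Coset.order_def carF using prime_factor_nat by blast
  then obtain x where x: "x \<in> carrier (G Mod N)" "F.ord x = p"
    using F.ex_element_of_prime_order[OF finF] by blast
  define P where "P = generate (G Mod N) {x}"
  have P: "subgroup P (G Mod N)" "card P = p" "x \<in> P"
    using F.generate_is_subgroup[of "{x}"] F.generate_pow_card[of x] x
    unfolding P_def by (auto intro: generate.incl)
  \<comment> \<open>The preimage of \<open>P\<close> under the projection to the quotient.\<close>
  let ?M = "{g \<in> carrier G. N #> g \<in> P}"
  have hom: "(\<lambda>g. N #> g) \<in> hom G (G Mod N)"
    by (rule N.r_coset_hom_Mod)
  interpret h: group_hom G "G Mod N" "\<lambda>g. N #> g"
    by unfold_locales (rule hom)
  have M: "subgroup ?M G"
  proof (rule subgroupI)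
    show "?M \<noteq> {}"
      using P(1) h.hom_one subgroup.one_closed by fastforce
    show "inv a \<in> ?M" if "a \<in> ?M" for a
      using that h.hom_inv[of a] subgroup.m_inv_closed[OF P(1)] by simp
    show "a \<otimes> b \<in> ?M" if "a \<in> ?M" "b \<in> ?M" for a b
      using that h.hom_mult[of a b] subgroup.m_closed[OF P(1)] by simp
  qed auto
  have one: "\<one>\<^bsub>G Mod N\<^esub> = N"
    by (simp add: FactGroup_def)
  have "N \<subseteq> ?M"
    using N.rcos_const N.subset subgroup.one_closed[OF P(1)] one by auto
  \<comment> \<open>A representative of the coset \<open>x\<close> lies in the preimage; if it were
    in \<open>N\<close>, then \<open>x\<close> would be trivial and its order 1.\<close>
  moreover have "N \<noteq> ?M"
  proof
    assume eq: "N = ?M"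
    obtain g where g: "g \<in> carrier G" "x = N #> g"
      using x(1) unfolding carF RCOSETS_def by auto
    then have "g \<in> ?M" using P(3) by simp
    then have "g \<in> N" using eq by simp
    then have "x = \<one>\<^bsub>G Mod N\<^esub>" using g N.rcos_const one by simp
    then have "p = 1" using x(2) F.ord_id by metis
    then show False using p(1) by simp
  qed
  moreover have "?M = carrier G" if "N \<subseteq> ?M" "N \<noteq> ?M"
  proof (rule ccontr)
    assume "?M \<noteq> carrier G"
    moreover have "derived G (carrier G) \<subseteq> ?M"
      using N by (intro order.trans[OF _ that(1)]) simp
    ultimately have "?M \<in> ?S"
      using M by simp
    then have "N = ?M"
      using that(1) by (rule max)
    with that(2) show False by (rule notE)
  qed
  ultimately have "?M = carrier G"
    by blast
  then have "N #> g \<in> P" if "g \<in> carrier G" for g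
    using that by blast
  then have "carrier (G Mod N) \<subseteq> P"
    unfolding carF RCOSETS_def by auto
  then have "P = carrier (G Mod N)"
    using subgroup.subset[OF P(1)] by blast
  then show ?thesis
    using P(2) p(1) carF N.normal_axioms by auto
qed

text \<open>A group of prime order is generated by some \<open>x\<close>, and sending
  \<open>x\<close> to a primitive \<open>p\<close>-th root of unity is faithful.\<close>

lemma ex_faithful_linear_character:
  assumes p: "Factorial_Ring.prime (Coset.order G)"
  shows "\<exists>f :: 'a \<Rightarrow> complex. (\<forall>a\<in>carrier G. \<forall>b\<in>carrier G. f (a \<otimes> b) = f a * f b)
    \<and> (\<forall>a\<in>carrier G. f a = 1 \<longleftrightarrow> a = \<one>)"
proof -
  define p where "p = Coset.order G"
  have pr: "Factorial_Ring.prime p" and p0: "p > 0"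
    using p prime_gt_0_nat unfolding p_def by auto
  have fin: "finite (carrier G)"
    using p0 unfolding p_def Coset.order_def by (simp add: card_gt_0_iff)
  have small: "Coset.order G < p * p"
    using prime_gt_1_nat[OF pr] unfolding p_def by simp
  have ord_p: "ord a = p" if "a \<in> carrier G" "a \<noteq> \<one>" for a
    using that ord_dvd_group_order[of a] pr ord_eq_1 unfolding p_def by (metis prime_nat_iff)
  obtain x where x: "x \<in> carrier G" "ord x = p"
    using ex_element_of_prime_order[OF fin pr] p_def by auto
  have "\<exists>i::nat. a = x [^] i" if "a \<in> carrier G" for a
  proof (cases "a = \<one>")
    case True
    then have "a = x [^] (0::nat)" by simp
    then show ?thesis by blast
  qed (use in_prime_order_cyclic_subgroup[OF fin pr small x that] ord_p that in blast)
  \<comment> \<open>A discrete logarithm to base \<open>x\<close>. Its values are arbitrary up to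
    multiples of \<open>p\<close>, which \<open>zmod\<close> shows to be harmless for powers of the
    root of unity.\<close>
  then obtain e :: "'a \<Rightarrow> nat" where e: "x [^] e a = a" if "a \<in> carrier G" for a
    by metis
  have pow_eq: "i mod p = j mod p" if "x [^] i = x [^] j" for i j :: nat
  proof -
    have "x [^] int i = x [^] int j" using that by (simp add: int_pow_int)
    then have "int p dvd int j - int i" using x by (simp add: int_pow_eq)
    then show ?thesis
      by (simp add: int_dvd_diff_iff_mod_eq)
  qed
  define \<zeta> where "\<zeta> = cis (2 * pi / real p)"
  have z: "\<zeta> ^ i = cis (2 * pi * real i / real p)" for i
    unfolding \<zeta>_def by (simp add: DeMoivre mult.commute)
  have zmod: "\<zeta> ^ i = \<zeta> ^ (i mod p)" for i
  proof -
    have "\<zeta> ^ p = 1" unfolding z using p0 by simp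
    then have "\<zeta> ^ (p * (i div p) + i mod p) = \<zeta> ^ (i mod p)"
      by (simp only: power_add power_mult) simp
    then show ?thesis by simp
  qed
  have inj: "i = 0" if "i < p" "\<zeta> ^ i = 1" for i
  proof -
    have "inj_on (\<lambda>k. cis (2 * pi * real k / real p)) {..<p}"
      using bij_betw_roots_unity[OF p0] by (rule bij_betw_imp_inj_on)
    then have "inj_on (\<lambda>k. \<zeta> ^ k) {..<p}" unfolding z .
    then show ?thesis using that p0 inj_onD[of "\<lambda>k. \<zeta> ^ k" "{..<p}" i 0] by simp
  qed
  show ?thesis
  proof (intro exI[of _ "\<lambda>a. \<zeta> ^ e a"] conjI ballI)
    fix a b assume ab: "a \<in> carrier G" "b \<in> carrier G"
    then have "x [^] e (a \<otimes> b) = x [^] (e a + e b)"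
      using ab x by (simp add: e flip: nat_pow_mult)
    then have "e (a \<otimes> b) mod p = (e a + e b) mod p" by (rule pow_eq)
    then show "\<zeta> ^ e (a \<otimes> b) = \<zeta> ^ e a * \<zeta> ^ e b"
      using zmod[of "e (a \<otimes> b)"] zmod[of "e a + e b"] by (simp add: power_add)
  next
    fix a assume a: "a \<in> carrier G"
    show "\<zeta> ^ e a = 1 \<longleftrightarrow> a = \<one>"
    proof
      assume "\<zeta> ^ e a = 1"
      then have "e a mod p = 0" using inj[of "e a mod p"] zmod[of "e a"] p0 by simp
      then show "a = \<one>" using e[OF a] x pow_eq_id[OF x(1), of "e a"] by auto
    next
      assume "a = \<one>"
      then have "x [^] e a = x [^] (0::nat)" using e[OF a] by simp
      then have "e a mod p = 0" using pow_eq[of "e a" 0] by simp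
      then show "\<zeta> ^ e a = 1" using zmod[of "e a"] by simp
    qed
  qed
qed

end

subsection \<open>Traces of matrices of finite order\<close>

lemma mat_trace_mult_commute:
  fixes A B :: "'c :: comm_semiring_0 mat"
  assumes "A \<in> carrier_mat n m" "B \<in> carrier_mat m n"
  shows "mat_trace (A * B) = mat_trace (B * A)"
proof -
  have "mat_trace (A * B) = (\<Sum>i<n. \<Sum>k<m. A $$ (i, k) * B $$ (k, i))"
    using assms by (simp add: mat_trace_def scalar_prod_def atLeast0LessThan)
  also have "\<dots> = (\<Sum>k<m. \<Sum>i<n. B $$ (k, i) * A $$ (i, k))"
    by (subst sum.swap) (simp add: mult.commute)
  also have "\<dots> = mat_trace (B * A)"
    using assms by (simp add: mat_trace_def scalar_prod_def atLeast0LessThan)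
  finally show ?thesis .
qed

lemma mat_trace_similar:
  fixes A :: "'c :: comm_ring_1 mat"
  assumes "similar_mat_wit A B P Q" "A \<in> carrier_mat n n"
  shows "mat_trace A = mat_trace B"
proof -
  note w = similar_mat_witD2[OF assms(2,1)]
  have "mat_trace A = mat_trace (P * (B * Q))"
    using w by (simp add: assoc_mult_mat[of P n n B n Q n])
  also have "\<dots> = mat_trace ((B * Q) * P)"
    using w by (intro mat_trace_mult_commute) auto
  also have "(B * Q) * P = B"
    using w by (simp add: assoc_mult_mat[of B n n Q n P n])
  finally show ?thesis .
qed

text \<open>The product \<open>A $$ (i, k) * B $$ (k, j)\<close> vanishes unless
  \<open>i \<le> k \<le> j\<close>. Below the diagonal no \<open>k\<close> remains, and on it only
  \<open>k = i\<close>.\<close>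

lemma upper_triangular_mult_diag:
  fixes A B :: "'c :: comm_ring_1 mat"
  assumes "A \<in> carrier_mat n n" "B \<in> carrier_mat n n" "upper_triangular A" "upper_triangular B"
  shows "upper_triangular (A * B)"
    and "\<And>i. i < n \<Longrightarrow> (A * B) $$ (i, i) = A $$ (i, i) * B $$ (i, i)"
proof -
  have *: "A $$ (i, k) * B $$ (k, j) = 0" if "i < n" "k < n" "k \<noteq> i \<or> j < i" "j \<le> i" for i j k
    using that assms upper_triangularD[OF assms(3), of k i] upper_triangularD[OF assms(4), of j k]
    by (cases "k < i") auto
  show "upper_triangular (A * B)"
    using assms(1,2) by (auto simp: upper_triangular_def scalar_prod_def * intro!: sum.neutral)
  fix i assume i: "i < n"
  have "(A * B) $$ (i, i) = (\<Sum>k\<in>{0..<n}. A $$ (i, k) * B $$ (k, i))"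
    using assms(1,2) i by (simp add: scalar_prod_def)
  also have "\<dots> = (\<Sum>k\<in>{0..<n}. if k = i then A $$ (i, i) * B $$ (i, i) else 0)"
    using i * by (intro sum.cong) auto
  finally show "(A * B) $$ (i, i) = A $$ (i, i) * B $$ (i, i)"
    using i by simp
qed

lemma upper_triangular_pow_diag:
  fixes A :: "'c :: comm_ring_1 mat"
  assumes "A \<in> carrier_mat n n" "upper_triangular A"
  shows "upper_triangular (A ^\<^sub>m k) \<and> (\<forall>i<n. (A ^\<^sub>m k) $$ (i, i) = A $$ (i, i) ^ k)"
proof (induction k)
  case 0
  then show ?case using assms by auto
next
  case (Suc k)
  have "A ^\<^sub>m k \<in> carrier_mat n n" using assms by simp
  then show ?case
    using upper_triangular_mult_diag[of "A ^\<^sub>m k" n A] assms Suc by (simp add: mult.commute)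
qed

section \<open>Finite sums of square matrices\<close>

text \<open>The dimension is an explicit argument because one type holds matrices of all sizes, so
  an empty sum does not determine its own size.\<close>

definition sum_mats :: "nat \<Rightarrow> ('i \<Rightarrow> 'c :: comm_monoid_add mat) \<Rightarrow> 'i set \<Rightarrow> 'c mat" where
  "sum_mats n f S = mat n n (\<lambda>ij. \<Sum>s\<in>S. f s $$ ij)"

lemma sum_mats_carrier [simp]: "sum_mats n f S \<in> carrier_mat n n"
  and sum_mats_dim [simp]: "dim_row (sum_mats n f S) = n" "dim_col (sum_mats n f S) = n"
  by (simp_all add: sum_mats_def)

lemma sum_mats_index [simp]: "i < n \<Longrightarrow> j < n \<Longrightarrow> sum_mats n f S $$ (i, j) = (\<Sum>s\<in>S. f s $$ (i, j))"
  by (simp add: sum_mats_def)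

lemma sum_mats_cong: "(\<And>s. s \<in> S \<Longrightarrow> f s = g s) \<Longrightarrow> sum_mats n f S = sum_mats n g S"
  by (simp add: sum_mats_def cong: sum.cong)

lemma sum_mats_reindex: "bij_betw h S T \<Longrightarrow> sum_mats n (\<lambda>s. f (h s)) S = sum_mats n f T"
  by (simp add: sum_mats_def sum.reindex_bij_betw[where g = "\<lambda>t. f t $$ ij" for ij])

lemma mult_sum_mats:
  fixes A :: "'c :: comm_ring_1 mat"
  assumes "A \<in> carrier_mat n n" "\<And>s. s \<in> S \<Longrightarrow> f s \<in> carrier_mat n n"
  shows "A * sum_mats n f S = sum_mats n (\<lambda>s. A * f s) S"
    and "sum_mats n f S * A = sum_mats n (\<lambda>s. f s * A) S"
proof -
  have "(A * sum_mats n f S) $$ (i, j) = sum_mats n (\<lambda>s. A * f s) S $$ (i, j)"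
    if "i < n" "j < n" for i j
  proof -
    have "(A * sum_mats n f S) $$ (i, j) = (\<Sum>k\<in>{0..<n}. \<Sum>s\<in>S. A $$ (i, k) * f s $$ (k, j))"
      using assms(1) that by (simp add: scalar_prod_def sum_distrib_left)
    also have "\<dots> = (\<Sum>s\<in>S. \<Sum>k\<in>{0..<n}. A $$ (i, k) * f s $$ (k, j))"
      by (rule sum.swap)
    also have "\<dots> = sum_mats n (\<lambda>s. A * f s) S $$ (i, j)"
      using assms(1) assms(2)[THEN carrier_matD(1)] assms(2)[THEN carrier_matD(2)] that
      by (auto simp: scalar_prod_def intro!: sum.cong)
    finally show ?thesis .
  qed
  then show "A * sum_mats n f S = sum_mats n (\<lambda>s. A * f s) S"
    using assms(1) by (intro eq_matI) auto
  have "(sum_mats n f S * A) $$ (i, j) = sum_mats n (\<lambda>s. f s * A) S $$ (i, j)"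
    if "i < n" "j < n" for i j
  proof -
    have "(sum_mats n f S * A) $$ (i, j) = (\<Sum>k\<in>{0..<n}. \<Sum>s\<in>S. f s $$ (i, k) * A $$ (k, j))"
      using assms(1) that by (simp add: scalar_prod_def sum_distrib_right)
    also have "\<dots> = (\<Sum>s\<in>S. \<Sum>k\<in>{0..<n}. f s $$ (i, k) * A $$ (k, j))"
      by (rule sum.swap)
    also have "\<dots> = sum_mats n (\<lambda>s. f s * A) S $$ (i, j)"
      using assms(1) assms(2)[THEN carrier_matD(1)] assms(2)[THEN carrier_matD(2)] that
      by (auto simp: scalar_prod_def intro!: sum.cong)
    finally show ?thesis .
  qed
  then show "sum_mats n f S * A = sum_mats n (\<lambda>s. f s * A) S"
    using assms(1) by (intro eq_matI) auto
qed

section \<open>Eigenvalues of complex matrices of finite order\<close>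

text \<open>The characteristic polynomial splits over the complex numbers, so a Schur decomposition
  exists.\<close>

lemma complex_triangularizable:
  fixes A :: "complex mat"
  assumes "A \<in> carrier_mat n n"
  obtains B P Q where "B \<in> carrier_mat n n" "upper_triangular B" "similar_mat_wit A B P Q"
proof -
  obtain as where "char_poly A = (\<Prod>a\<leftarrow>as. [:- a, 1:])"
    using char_poly_factorized[OF assms] by blast
  from schur_decomposition_exists[OF assms this] show thesis
    using that unfolding similar_mat_def by blast
qed

text \<open>The averaging matrix \<open>\<Sum>i<m. A\<^sup>i\<close> is fixed by \<open>A\<close> and has determinant \<open>m\<^sup>n\<close>.\<close>

lemma unipotent_of_finite_order:
  fixes A :: "complex mat"
  assumes A: "A \<in> carrier_mat n n" "upper_triangular A" and diag: "\<And>i. i < n \<Longrightarrow> A $$ (i, i) = 1"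
    and m: "m > 0" "A ^\<^sub>m m = 1\<^sub>m n"
  shows "A = 1\<^sub>m n"
proof -
  let ?S = "sum_mats n (\<lambda>i. A ^\<^sub>m i) {..<m}"
  note pow = upper_triangular_pow_diag[OF A]
  have "upper_triangular ?S"
  proof (rule upper_triangularI)
    fix i j assume "j < i" "i < dim_row ?S"
    moreover have "(A ^\<^sub>m k) $$ (i, j) = 0" for k
      using upper_triangularD[of "A ^\<^sub>m k" j i] pow[of k] A(1) calculation by simp
    ultimately show "?S $$ (i, j) = 0" by simp
  qed
  \<comment> \<open>Each of the \<open>m\<close> powers has diagonal entries 1. Hence the
    determinant of the triangular sum is nonzero and the sum can be cancelled at the end.\<close>
  moreover have "?S $$ (i, i) = of_nat m" if "i < n" for i
    using that pow diag by simp
  ultimately have "det ?S \<noteq> 0"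
    using m(1) upper_triangular_imp_det_eq_0_iff[of ?S n] by (auto simp: diag_mat_def)
  then obtain R where R: "R \<in> carrier_mat n n" "?S * R = 1\<^sub>m n"
    using det_non_zero_imp_unit[of ?S n, where b = "()"] unfolding Units_def by (auto simp: ring_mat_simps)
  have "A * ?S = sum_mats n (\<lambda>i. A * A ^\<^sub>m i) {..<m}"
    using A(1) by (intro mult_sum_mats) auto
  also have "\<dots> = sum_mats n (\<lambda>i. A ^\<^sub>m (Suc i)) {..<m}"
  proof (rule sum_mats_cong)
    fix i
    have "A * A ^\<^sub>m i = A ^\<^sub>m i * A" for i
    proof (induction i)
      case (Suc i)
      have c: "A ^\<^sub>m i \<in> carrier_mat n n" using A(1) by simp
      have "A * A ^\<^sub>m Suc i = (A * A ^\<^sub>m i) * A" using A(1) c by (simp add: assoc_mult_mat[of A n n _ n A n])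
      then show ?case using Suc by simp
    qed (use A in simp)
    then show "A * A ^\<^sub>m i = A ^\<^sub>m Suc i" by simp
  qed
  \<comment> \<open>Shifting the index by one only trades the term \<open>A ^\<^sub>m 0\<close> for
    \<open>A ^\<^sub>m m\<close>, and both are the identity.\<close>
  also have "\<dots> = ?S"
  proof -
    have "(\<Sum>i<m. (A ^\<^sub>m Suc i) $$ ij) = (\<Sum>i<m. (A ^\<^sub>m i) $$ ij)" for ij
    proof -
      have "(\<Sum>i<m. (A ^\<^sub>m Suc i) $$ ij) + (A ^\<^sub>m 0) $$ ij = (\<Sum>i<m. (A ^\<^sub>m i) $$ ij) + (A ^\<^sub>m m) $$ ij"
        using sum.lessThan_Suc_shift[of "\<lambda>i. (A ^\<^sub>m i) $$ ij" m]
          sum.lessThan_Suc[of "\<lambda>i. (A ^\<^sub>m i) $$ ij" m] by (metis add.commute)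
      then show ?thesis using m(2) A(1) by simp
    qed
    then show ?thesis unfolding sum_mats_def by presburger
  qed
  finally have "(A * ?S) * R = ?S * R"
    by (rule arg_cong)
  then have "A * (?S * R) = ?S * R"
    by (simp only: assoc_mult_mat[OF A(1) sum_mats_carrier R(1)])
  then show ?thesis using R A(1) by simp
qed

text \<open>The equality case of the triangle inequality: real parts are at most 1 and sum to the
  number of terms, so each is 1, and modulus 1 then kills the imaginary part.\<close>

lemma sum_unit_complex_eq_card:
  fixes f :: "'i \<Rightarrow> complex"
  assumes "finite S" "\<And>i. i \<in> S \<Longrightarrow> norm (f i) = 1" "(\<Sum>i\<in>S. f i) = of_nat (card S)" "i \<in> S"
  shows "f i = 1"
proof -
  have le: "Re (f i) \<le> 1" if "i \<in> S" for i
    using complex_Re_le_cmod[of "f i"] assms(2)[OF that] by simp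
  have "(\<Sum>i\<in>S. Re (f i)) = real (card S)"
    using arg_cong[OF assms(3), of Re] by simp
  then have "(\<Sum>i\<in>S. 1 - Re (f i)) = 0"
    by (simp add: sum_subtractf)
  then have "1 - Re (f i) = 0"
    using sum_nonneg_eq_0_iff[OF assms(1), of "\<lambda>i. 1 - Re (f i)"] le assms(4) by simp
  moreover have "(Re (f i))\<^sup>2 + (Im (f i))\<^sup>2 = 1"
    using assms(2)[OF assms(4)] by (metis cmod_power2 power_one)
  ultimately show ?thesis by (simp add: complex_eq_iff)
qed

text \<open>After triangularization the diagonal entries are roots of unity. Trace \<open>n\<close>
  forces them all to be 1, leaving a unipotent matrix of finite order, hence the identity. For a
  root of unity \<open>b\<close> with \<open>b ^ m = 1\<close>, the power \<open>b ^ (m - 1)\<close>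
  is its inverse, which is its conjugate.\<close>

lemma finite_order_mat:
  fixes A :: "complex mat"
  assumes A: "A \<in> carrier_mat n n" and m: "m > 0" "A ^\<^sub>m m = 1\<^sub>m n"
  shows mat_trace_eq_dim_iff: "mat_trace A = of_nat n \<longleftrightarrow> A = 1\<^sub>m n"
    and mat_trace_pow_pred: "mat_trace (A ^\<^sub>m (m - 1)) = cnj (mat_trace A)"
proof -
  obtain B P Q where B: "B \<in> carrier_mat n n" "upper_triangular B" and sim: "similar_mat_wit A B P Q"
    using complex_triangularizable[OF A] by blast
  note w = similar_mat_witD2[OF A sim]
  have pow: "(B ^\<^sub>m k) $$ (i, i) = B $$ (i, i) ^ k" if "i < n" for i k
    using upper_triangular_pow_diag[OF B] that by blast
  have "similar_mat_wit (B ^\<^sub>m m) (1\<^sub>m n) Q P"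
    using similar_mat_wit_pow[OF similar_mat_wit_sym[OF sim], of m] m(2) by simp
  from similar_mat_witD2[OF _ this, of n n] have Bm: "B ^\<^sub>m m = 1\<^sub>m n"
    using B(1) w by simp
  have root: "B $$ (i, i) ^ m = 1" if "i < n" for i
    using pow[OF that, of m] Bm that by simp
  then have unit: "norm (B $$ (i, i)) = 1" if "i < n" for i
    using that m(1) by (metis norm_power norm_one norm_ge_zero power_eq_1_iff neq0_conv)
  have trA: "mat_trace A = (\<Sum>i<n. B $$ (i, i))"
    using mat_trace_similar[OF sim A] B(1) by (simp add: mat_trace_def)
  show "mat_trace A = of_nat n \<longleftrightarrow> A = 1\<^sub>m n"
  proof
    assume "mat_trace A = of_nat n"
    then have "B $$ (i, i) = 1" if "i < n" for i
      using sum_unit_complex_eq_card[of "{..<n}" "\<lambda>i. B $$ (i, i)" i] unit that trA by simp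
    then have "B = 1\<^sub>m n"
      using unipotent_of_finite_order[OF B _ m(1) Bm] by blast
    then show "A = 1\<^sub>m n"
      using w by simp
  qed (simp add: mat_trace_def)
  have "mat_trace (A ^\<^sub>m (m - 1)) = mat_trace (B ^\<^sub>m (m - 1))"
    by (rule mat_trace_similar[OF similar_mat_wit_pow[OF sim] pow_carrier_mat[OF A]])
  also have "\<dots> = (\<Sum>i<n. B $$ (i, i) ^ (m - 1))"
    using B(1) pow by (simp add: mat_trace_def)
  also have "\<dots> = (\<Sum>i<n. cnj (B $$ (i, i)))"
  proof (rule sum.cong)
    fix i assume "i \<in> {..<n}"
    then have i: "i < n" by simp
    let ?b = "B $$ (i, i)"
    have "?b ^ (m - 1) * ?b = 1"
      using root[OF i] m(1) by (metis Suc_diff_1 power_Suc2)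
    moreover have "?b * cnj ?b = 1"
      using unit[OF i] complex_norm_square[of ?b] by simp
    ultimately show "?b ^ (m - 1) = cnj ?b"
      by (metis mult.assoc mult.left_neutral mult.right_neutral)
  qed simp
  finally show "mat_trace (A ^\<^sub>m (m - 1)) = cnj (mat_trace A)"
    unfolding trA by simp
qed

subsection \<open>Irreducible representations\<close>

lemma group_GL: "Group.group (GL n)"
proof -
  interpret ring "ring_mat TYPE(complex) n ()" by (rule ring_mat)
  show ?thesis unfolding GL_def by (rule units_group)
qed

lemma GL_simps:
  "monoid.mult (GL n) = (*)" "monoid.one (GL n) = 1\<^sub>m n" "carrier (GL n) \<subseteq> carrier_mat n n"
  by (auto simp: GL_def units_of_def Units_def ring_mat_simps)

lemma (in vec_space) subspaceI:
  assumes "W \<subseteq> carrier_vec n" "0\<^sub>v n \<in> W" "\<And>v w. v \<in> W \<Longrightarrow> w \<in> W \<Longrightarrow> v + w \<in> W"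
    "\<And>c v. v \<in> W \<Longrightarrow> c \<cdot>\<^sub>v v \<in> W"
  shows "VectorSpace.subspace class_ring W V"
  by (intro subspace.intro submodule.intro vec_vs vec_module module_axioms) (use assms in \<open>auto simp: module_vec_simps class_ring_simps\<close>)

section \<open>Representations of finite groups, their characters and kernels\<close>

locale finite_group_rep = Group.group G for G (structure) +
  fixes n :: nat and \<rho> :: "'a \<Rightarrow> complex mat"
  assumes fin: "finite (carrier G)" and rep: "representation G n \<rho>"
begin

lemma rho_group_hom: "group_hom G (GL n) \<rho>"
  using rep unfolding representation_def
  by (intro group_hom.intro group_hom_axioms.intro group_GL group_axioms)

lemma rho_carrier [simp]: "g \<in> carrier G \<Longrightarrow> \<rho> g \<in> carrier_mat n n"
  using group_hom.hom_closed[OF rho_group_hom] GL_simps(3) by blast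

lemma rho_dim [simp]: "g \<in> carrier G \<Longrightarrow> dim_row (\<rho> g) = n" "g \<in> carrier G \<Longrightarrow> dim_col (\<rho> g) = n"
  using rho_carrier by blast+

lemma rho_mult: "g \<in> carrier G \<Longrightarrow> h \<in> carrier G \<Longrightarrow> \<rho> (g \<otimes> h) = \<rho> g * \<rho> h"
  using group_hom.hom_mult[OF rho_group_hom] by (simp add: GL_simps)

lemma rho_one: "\<rho> \<one> = 1\<^sub>m n"
  using group_hom.hom_one[OF rho_group_hom] by (simp add: GL_simps)

lemma rho_pow: "g \<in> carrier G \<Longrightarrow> \<rho> (g [^] (k::nat)) = \<rho> g ^\<^sub>m k"
  by (induction k) (simp_all add: rho_one rho_mult)

lemma rho_inv: "g \<in> carrier G \<Longrightarrow> \<rho> g * \<rho> (inv g) = 1\<^sub>m n" "g \<in> carrier G \<Longrightarrow> \<rho> (inv g) * \<rho> g = 1\<^sub>m n"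
  by (simp_all flip: rho_mult add: rho_one)

abbreviation "\<chi> \<equiv> character_of G \<rho>"
abbreviation "K \<equiv> char_ker G \<chi>"

lemma chi_eq: "g \<in> carrier G \<Longrightarrow> \<chi> g = mat_trace (\<rho> g)"
  by (simp add: character_of_def)

lemma chi_one: "\<chi> \<one> = of_nat n"
  by (simp add: chi_eq rho_one mat_trace_def)

lemma order_pos: "Coset.order G > 0"
  using fin by (auto simp: Coset.order_def card_gt_0_iff)

lemma rho_finite_order: "g \<in> carrier G \<Longrightarrow> \<rho> g ^\<^sub>m Coset.order G = 1\<^sub>m n"
  by (simp flip: rho_pow add: pow_order_eq_1 rho_one)

text \<open>Each \<open>\<rho> g\<close> has finite order, so its trace equals the degree only if it
  is the identity. This links the kernel of the character to that of the representation.\<close>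

lemma char_ker_eq: "K = {g \<in> carrier G. \<rho> g = 1\<^sub>m n}"
  using mat_trace_eq_dim_iff[OF rho_carrier order_pos rho_finite_order]
  by (simp add: char_ker_def chi_one chi_eq cong: conj_cong)

lemma char_ker_kernel: "K = kernel G (GL n) \<rho>"
  by (simp add: char_ker_eq kernel_def GL_simps)

text \<open>With \<open>m\<close> the group order, the inverse of \<open>g\<close> is its power with
  exponent \<open>m - 1\<close>, whose trace is already known to be the conjugate.\<close>

lemma chi_inv:
  assumes "g \<in> carrier G"
  shows "\<chi> (inv g) = cnj (\<chi> g)"
proof -
  let ?m = "Coset.order G"
  have "g [^] (?m - 1) \<otimes> g = \<one>"
    using assms order_pos pow_order_eq_1[OF assms] by (metis Suc_diff_1 nat_pow_Suc)
  then have "inv g = g [^] (?m - 1)"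
    using assms by (simp add: inv_equality)
  then show ?thesis
    using assms mat_trace_pow_pred[OF rho_carrier order_pos rho_finite_order]
    by (simp only: chi_eq rho_pow nat_pow_closed)
qed

end

section \<open>Schur's lemma and character sums\<close>

locale finite_group_irrep = finite_group_rep +
  assumes irred: "irreducible_representation G n \<rho>"
begin

lemma n_pos: "0 < n"
  using irred unfolding irreducible_representation_def by simp

text \<open>An eigenspace of \<open>T\<close> is nonzero and, as \<open>T\<close> commutes with the
  representation, invariant. Irreducibility makes it the whole space.\<close>

lemma schur:
  assumes T: "T \<in> carrier_mat n n" and comm: "\<And>g. g \<in> carrier G \<Longrightarrow> \<rho> g * T = T * \<rho> g"
  shows "\<exists>c. T = c \<cdot>\<^sub>m 1\<^sub>m n"
proof -
  obtain c v where v: "v \<in> carrier_vec n" "v \<noteq> 0\<^sub>v n" "T *\<^sub>v v = c \<cdot>\<^sub>v v"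
    using spectrum_non_empty[OF T n_pos] T
    unfolding spectrum_def eigenvalue_def eigenvector_def by auto
  let ?W = "{w \<in> carrier_vec n. T *\<^sub>v w = c \<cdot>\<^sub>v w}"
  interpret vec_space "TYPE(complex)" n .
  have "VectorSpace.subspace class_ring ?W (module_vec TYPE(complex) n)"
  proof (rule subspaceI)
    fix a w assume "w \<in> ?W"
    then show "a \<cdot>\<^sub>v w \<in> ?W"
      using T by (simp add: mult_mat_vec[OF T] smult_smult_assoc mult.commute)
  qed (use T in \<open>auto simp: mult_add_distrib_mat_vec smult_add_distrib_vec\<close>)
  moreover have "\<rho> g *\<^sub>v w \<in> ?W" if g: "g \<in> carrier G" and w: "w \<in> ?W" for g w
  proof -
    have "T *\<^sub>v (\<rho> g *\<^sub>v w) = \<rho> g *\<^sub>v (T *\<^sub>v w)"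
      using w comm[OF g] assoc_mult_mat_vec[OF T rho_carrier[OF g]] assoc_mult_mat_vec[OF rho_carrier[OF g] T]
      by simp
    also have "\<dots> = c \<cdot>\<^sub>v (\<rho> g *\<^sub>v w)"
      using w mult_mat_vec[OF rho_carrier[OF g]] by simp
    finally show ?thesis using w mult_mat_vec_carrier[OF rho_carrier[OF g]] by simp
  qed
  ultimately have "invariant_subspace G n \<rho> ?W"
    unfolding invariant_subspace_def by blast
  then have "?W = {0\<^sub>v n} \<or> ?W = carrier_vec n"
    using irred unfolding irreducible_representation_def by blast
  moreover have "v \<in> ?W" using v by simp
  ultimately have W: "?W = carrier_vec n"
    using v(2) by blast
  have "T $$ (i, j) = (c \<cdot>\<^sub>m 1\<^sub>m n) $$ (i, j)" if "i < n" "j < n" for i j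
  proof -
    have "unit_vec n j \<in> ?W" unfolding W by simp
    then have "(T *\<^sub>v unit_vec n j) $ i = (c \<cdot>\<^sub>v unit_vec n j) $ i" by simp
    then show ?thesis using T that by (simp add: scalar_prod_right_unit)
  qed
  then have "T = c \<cdot>\<^sub>m 1\<^sub>m n"
    using T by (intro eq_matI) auto
  then show ?thesis ..
qed

lemma bij_left_mult: "h \<in> carrier G \<Longrightarrow> bij_betw (\<lambda>g. h \<otimes> g) (carrier G) (carrier G)"
  by (rule bij_betw_byWitness[of _ "\<lambda>g. inv h \<otimes> g"]) (auto simp flip: m_assoc)

text \<open>Summing the conjugates of \<open>A\<close> over the group gives a matrix commuting with
  the representation, so Schur's lemma applies; comparing traces determines the scalar.\<close>

lemma averaged_mat_scalar:
  assumes A: "A \<in> carrier_mat n n"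
  obtains c where "sum_mats n (\<lambda>g. \<rho> g * A * \<rho> (inv g)) (carrier G) = c \<cdot>\<^sub>m 1\<^sub>m n"
    and "c * of_nat n = of_nat (Coset.order G) * mat_trace A"
proof -
  let ?f = "\<lambda>g. \<rho> g * A * \<rho> (inv g)"
  let ?T = "sum_mats n ?f (carrier G)"
  have f: "?f g \<in> carrier_mat n n" if "g \<in> carrier G" for g
    using that A by (intro mult_carrier_mat[of _ n n _ n] rho_carrier inv_closed)
  have "\<rho> h * ?T = ?T * \<rho> h" if h: "h \<in> carrier G" for h
  proof -
    \<comment> \<open>Replacing \<open>g\<close> by \<open>h \<otimes> g\<close> produces
      \<open>\<rho> h\<close> on the left and \<open>\<rho> (inv h)\<close> on the right, which
      cancels the extra factor.\<close>
    have "?T * \<rho> h = sum_mats n (\<lambda>g. ?f (h \<otimes> g)) (carrier G) * \<rho> h"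
      by (simp only: sum_mats_reindex[OF bij_left_mult[OF h], of n ?f])
    also have "\<dots> = sum_mats n (\<lambda>g. ?f (h \<otimes> g) * \<rho> h) (carrier G)"
      using h f by (intro mult_sum_mats) auto
    also have "\<dots> = sum_mats n (\<lambda>g. \<rho> h * ?f g) (carrier G)"
    proof (rule sum_mats_cong)
      fix g assume g: "g \<in> carrier G"
      note c = rho_carrier[OF h] rho_carrier[OF g] A rho_carrier[OF inv_closed[OF g]] rho_carrier[OF inv_closed[OF h]]
      have "?f (h \<otimes> g) * \<rho> h = (\<rho> h * \<rho> g) * A * (\<rho> (inv g) * \<rho> (inv h)) * \<rho> h"
        using g h by (simp add: rho_mult inv_mult_group)
      also have "\<dots> = \<rho> h * ?f g * (\<rho> (inv h) * \<rho> h)"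
        using c by (simp add: assoc_mult_mat[of _ n n _ n _ n] )
      also have "\<dots> = \<rho> h * ?f g"
        using c by (simp add: rho_inv(2)[OF h])
      finally show "?f (h \<otimes> g) * \<rho> h = \<rho> h * ?f g" .
    qed
    also have "\<dots> = \<rho> h * ?T"
      using h f by (intro mult_sum_mats[symmetric]) auto
    finally show ?thesis ..
  qed
  then obtain c where c: "?T = c \<cdot>\<^sub>m 1\<^sub>m n"
    using schur[of ?T] by auto
  have "mat_trace ?T = (\<Sum>g\<in>carrier G. mat_trace (?f g))"
    using f by (simp add: mat_trace_def) (subst sum.swap, simp)
  also have "\<dots> = (\<Sum>g\<in>carrier G. mat_trace A)"
  proof (rule sum.cong)
    fix g assume g: "g \<in> carrier G"
    note c = rho_carrier[OF g] A rho_carrier[OF inv_closed[OF g]]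
    have "mat_trace (?f g) = mat_trace (\<rho> (inv g) * (\<rho> g * A))"
      using c by (intro mat_trace_mult_commute) auto
    also have "\<rho> (inv g) * (\<rho> g * A) = (\<rho> (inv g) * \<rho> g) * A"
      using c by (simp add: assoc_mult_mat[of _ n n _ n _ n])
    finally show "mat_trace (?f g) = mat_trace A"
      using A by (simp add: rho_inv(2)[OF g])
  qed simp
  finally have "mat_trace ?T = of_nat (Coset.order G) * mat_trace A"
    by (simp add: Coset.order_def)
  moreover have "mat_trace ?T = c * of_nat n"
    unfolding c by (simp add: mat_trace_def mult.commute)
  ultimately show thesis using that c by simp
qed

text \<open>The first orthogonality relation for a character with itself. Averaging the matrix unit
  \<open>E i j\<close> and reading off entry \<open>(i, j)\<close> evaluates the sum of
  \<open>\<rho> g $$ (i, i) * \<rho> (inv g) $$ (j, j)\<close> over the group; summing over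
  \<open>i\<close> and \<open>j\<close> gives the characters.\<close>

lemma character_orthogonality: "(\<Sum>g\<in>carrier G. \<chi> g * \<chi> (inv g)) = of_nat (Coset.order G)"
proof -
  define E :: "nat \<Rightarrow> nat \<Rightarrow> complex mat"
    where "E i j = mat n n (\<lambda>(a, b). if a = i \<and> b = j then 1 else 0)" for i j
  have E: "E i j \<in> carrier_mat n n" for i j
    by (simp add: E_def)
  have trE: "mat_trace (E i j) = (if i = j then 1 else 0)" if "i < n" for i j
  proof -
    have "mat_trace (E i j) = (\<Sum>a<n. if a = i then (if i = j then 1 else 0) else 0)"
      unfolding mat_trace_def by (intro sum.cong) (auto simp: E_def)
    then show ?thesis using that by simp
  qed
  have entry: "(\<rho> g * E i j * \<rho> (inv g)) $$ (i, j) = \<rho> g $$ (i, i) * \<rho> (inv g) $$ (j, j)"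
    if "i < n" "j < n" "g \<in> carrier G" for i j g
  proof -
    have "(\<rho> g * E i j) $$ (i, b) = (if b = j then \<rho> g $$ (i, i) else 0)" if b: "b < n" for b
    proof -
      have "(\<rho> g * E i j) $$ (i, b) = (\<Sum>a\<in>{0..<n}. \<rho> g $$ (i, a) * E i j $$ (a, b))"
        using \<open>i < n\<close> b \<open>g \<in> carrier G\<close> E[of i j] by (auto simp: scalar_prod_def)
      also have "\<dots> = (\<Sum>a\<in>{0..<n}. if a = i then (if b = j then \<rho> g $$ (i, i) else 0) else 0)"
        using b by (intro sum.cong) (auto simp: E_def)
      finally show ?thesis using \<open>i < n\<close> by simp
    qed
    moreover have "(\<rho> g * E i j * \<rho> (inv g)) $$ (i, j)
        = (\<Sum>b\<in>{0..<n}. (\<rho> g * E i j) $$ (i, b) * \<rho> (inv g) $$ (b, j))"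
      using that E[of i j] by (subst index_mult_mat) (auto simp: scalar_prod_def simp del: index_mult_mat(1))
    moreover have "(\<Sum>b\<in>{0..<n}. (if b = j then \<rho> g $$ (i, i) else 0) * \<rho> (inv g) $$ (b, j))
        = (\<Sum>b\<in>{0..<n}. if b = j then \<rho> g $$ (i, i) * \<rho> (inv g) $$ (j, j) else 0)"
      by (intro sum.cong) auto
    ultimately show ?thesis using that by (simp del: index_mult_mat(1))
  qed
  have sum_entry: "(\<Sum>g\<in>carrier G. \<rho> g $$ (i, i) * \<rho> (inv g) $$ (j, j))
      = (if i = j then of_nat (Coset.order G) / of_nat n else 0)"
    if ij: "i < n" "j < n" for i j
  proof -
    obtain c where c: "sum_mats n (\<lambda>g. \<rho> g * E i j * \<rho> (inv g)) (carrier G) = c \<cdot>\<^sub>m 1\<^sub>m n"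
      and cn: "c * of_nat n = of_nat (Coset.order G) * mat_trace (E i j)"
      using averaged_mat_scalar[OF E] by blast
    have "(\<Sum>g\<in>carrier G. \<rho> g $$ (i, i) * \<rho> (inv g) $$ (j, j))
        = sum_mats n (\<lambda>g. \<rho> g * E i j * \<rho> (inv g)) (carrier G) $$ (i, j)"
      using ij by (simp add: entry del: index_mult_mat(1))
    also have "\<dots> = (if i = j then c else 0)"
      unfolding c using ij by simp
    also have "\<dots> = (if i = j then of_nat (Coset.order G) / of_nat n else 0)"
      using cn n_pos ij by (simp add: trE field_simps)
    finally show ?thesis .
  qed
  have "(\<Sum>g\<in>carrier G. \<chi> g * \<chi> (inv g))
      = (\<Sum>g\<in>carrier G. \<Sum>i<n. \<Sum>j<n. \<rho> g $$ (i, i) * \<rho> (inv g) $$ (j, j))"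
    by (intro sum.cong) (simp_all add: chi_eq mat_trace_def sum_product)
  also have "\<dots> = (\<Sum>i<n. \<Sum>j<n. \<Sum>g\<in>carrier G. \<rho> g $$ (i, i) * \<rho> (inv g) $$ (j, j))"
    by (subst sum.swap, intro sum.cong refl, rule sum.swap)
  also have "\<dots> = (\<Sum>i<n. \<Sum>j<n. if i = j then of_nat (Coset.order G) / of_nat n else 0)"
    by (intro sum.cong refl sum_entry) auto
  also have "\<dots> = of_nat (Coset.order G)"
    using n_pos by simp
  finally show ?thesis .
qed

text \<open>Orthogonality to the trivial character. The sum of all \<open>\<rho> g\<close> is a
  scalar matrix by Schur's lemma and absorbs \<open>\<rho> h\<close>, which is impossible for a
  nonzero scalar.\<close>

lemma sum_character_eq_0:
  assumes h: "h \<in> carrier G" "\<rho> h \<noteq> 1\<^sub>m n"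
  shows "(\<Sum>g\<in>carrier G. \<chi> g) = 0"
proof -
  let ?S = "sum_mats n \<rho> (carrier G)"
  have bij_right: "bij_betw (\<lambda>g. g \<otimes> k) (carrier G) (carrier G)" if "k \<in> carrier G" for k
    using that by (intro bij_betw_byWitness[of _ "\<lambda>g. g \<otimes> inv k"]) (auto simp: m_assoc)
  have left: "\<rho> k * ?S = ?S" if k: "k \<in> carrier G" for k
  proof -
    have "\<rho> k * ?S = sum_mats n (\<lambda>g. \<rho> k * \<rho> g) (carrier G)"
      using k by (intro mult_sum_mats) auto
    also have "\<dots> = sum_mats n (\<lambda>g. \<rho> (k \<otimes> g)) (carrier G)"
      using k by (intro sum_mats_cong) (simp add: rho_mult)
    also have "\<dots> = ?S" by (rule sum_mats_reindex[OF bij_left_mult[OF k]])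
    finally show ?thesis .
  qed
  have right: "?S * \<rho> k = ?S" if k: "k \<in> carrier G" for k
  proof -
    have "?S * \<rho> k = sum_mats n (\<lambda>g. \<rho> g * \<rho> k) (carrier G)"
      using k by (intro mult_sum_mats) auto
    also have "\<dots> = sum_mats n (\<lambda>g. \<rho> (g \<otimes> k)) (carrier G)"
      using k by (intro sum_mats_cong) (simp add: rho_mult)
    also have "\<dots> = ?S" by (rule sum_mats_reindex[OF bij_right[OF k]])
    finally show ?thesis .
  qed
  obtain c where c: "?S = c \<cdot>\<^sub>m 1\<^sub>m n"
    using schur[of ?S] left right by auto
  have "c = 0"
  proof (rule ccontr)
    assume "c \<noteq> 0"
    have "c \<cdot>\<^sub>m \<rho> h = c \<cdot>\<^sub>m 1\<^sub>m n"
      using left[OF h(1)] mult_smult_distrib[OF rho_carrier[OF h(1)] one_carrier_mat, of c] rho_carrier[OF h(1)]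
      unfolding c by simp
    then have entry: "(c \<cdot>\<^sub>m \<rho> h) $$ (i, j) = (c \<cdot>\<^sub>m 1\<^sub>m n) $$ (i, j)" for i j
      by (rule arg_cong)
    have "\<rho> h $$ (i, j) = 1\<^sub>m n $$ (i, j)" if "i < n" "j < n" for i j
      using entry[of i j] that \<open>c \<noteq> 0\<close> h(1) by (auto split: if_splits)
    then have "\<rho> h = 1\<^sub>m n"
      using h(1) by (intro eq_matI) auto
    then show False using h(2) by simp
  qed
  have "(\<Sum>g\<in>carrier G. \<chi> g) = (\<Sum>g\<in>carrier G. \<Sum>i<n. \<rho> g $$ (i, i))"
    by (intro sum.cong) (simp_all add: chi_eq mat_trace_def)
  also have "\<dots> = mat_trace ?S"
    by (subst sum.swap) (simp add: mat_trace_def)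
  also have "\<dots> = 0"
    unfolding c \<open>c = 0\<close> by (simp add: mat_trace_def)
  finally show ?thesis .
qed

text \<open>In the sum of squared absolute values of the character, \<open>K\<close> alone
  contributes \<open>n * n * card K\<close>. The inequality is strict: a character vanishing off
  \<open>K\<close> would have sum \<open>n * card K\<close>, not 0.\<close>

lemma degree_squared_less:
  assumes h: "h \<in> carrier G" "\<rho> h \<noteq> 1\<^sub>m n"
  shows "n * n * card K < Coset.order G"
proof -
  have KG: "K \<subseteq> carrier G" by (auto simp: char_ker_def)
  have chiK: "\<chi> g = of_nat n" if "g \<in> K" for g
    using that by (simp add: char_ker_def chi_one)
  have oneK: "\<one> \<in> K" by (simp add: char_ker_def)
  then have cK: "card K > 0"
    using fin KG finite_subset by (auto simp: card_gt_0_iff)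
  have "of_real (\<Sum>g\<in>carrier G. (norm (\<chi> g))\<^sup>2) = (\<Sum>g\<in>carrier G. \<chi> g * \<chi> (inv g))"
    unfolding of_real_sum by (intro sum.cong) (simp_all only: chi_inv complex_norm_square)
  then have norm_sum: "(\<Sum>g\<in>carrier G. (norm (\<chi> g))\<^sup>2) = real (Coset.order G)"
    unfolding character_orthogonality by (metis of_real_eq_iff of_real_of_nat_eq)
  have split: "sum f (carrier G) = sum f (carrier G - K) + sum f K" for f :: "'a \<Rightarrow> 'z :: comm_monoid_add"
    by (rule sum.subset_diff[OF KG fin])
  have eq: "real (Coset.order G) = (\<Sum>g\<in>carrier G - K. (norm (\<chi> g))\<^sup>2) + real (n * n * card K)"
    using chiK unfolding norm_sum[symmetric] split by (simp add: power2_eq_square)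
  have "(\<Sum>g\<in>carrier G - K. (norm (\<chi> g))\<^sup>2) \<noteq> 0"
  proof
    assume "(\<Sum>g\<in>carrier G - K. (norm (\<chi> g))\<^sup>2) = 0"
    then have "\<chi> g = 0" if "g \<in> carrier G - K" for g
      using sum_nonneg_eq_0_iff[of "carrier G - K" "\<lambda>g. (norm (\<chi> g))\<^sup>2"] fin that by auto
    then have "(\<Sum>g\<in>carrier G. \<chi> g) = of_nat (card K) * of_nat n"
      unfolding split using chiK by simp
    then show False using sum_character_eq_0[OF h] cK n_pos by simp
  qed
  moreover have "(\<Sum>g\<in>carrier G - K. (norm (\<chi> g))\<^sup>2) \<ge> 0"
    by (rule sum_nonneg) simp
  ultimately have "real (n * n * card K) < real (Coset.order G)"
    unfolding eq by linarith
  then show ?thesis by (simp only: of_nat_less_iff)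
qed

end

subsection \<open>Prime codegrees\<close>

lemma (in finite_group_irrep) perfect_imp_cod_not_prime:
  assumes perf: "perfect G" and p: "Factorial_Ring.prime p"
  shows "cod G \<chi> \<noteq> of_nat p"
proof
  interpret rho: group_hom G "GL n" \<rho>
    by (rule rho_group_hom)
  assume "cod G \<chi> = of_nat p"
  then have "(of_nat (card (rcosets K)) :: complex) = of_nat (p * n)"
    using n_pos by (simp add: cod_def chi_one field_simps)
  then have index: "card (rcosets K) = p * n"
    by (simp only: of_nat_eq_iff)
  have K: "subgroup K G"
    unfolding char_ker_kernel by (rule rho.subgroup_kernel)
  have order: "p * n * card K = Coset.order G"
    using lagrange[OF K] index by simp
  have cK: "card K > 0"
    using order order_pos by (metis mult_0_right neq0_conv)
  \<comment> \<open>For a trivial representation the kernel would have index 1, while the index is a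
    multiple of the prime \<open>p\<close>.\<close>
  have "\<exists>h\<in>carrier G. \<rho> h \<noteq> 1\<^sub>m n"
  proof (rule ccontr)
    assume "\<not> ?thesis"
    then have "K = carrier G"
      by (auto simp: char_ker_eq)
    then have "p * n * card (carrier G) = card (carrier G)"
      using order by (simp add: Coset.order_def)
    then have "p * n = 1"
      using order_pos by (simp add: Coset.order_def)
    then show False using p by simp
  qed
  then have "n * n * card K < p * n * card K"
    using degree_squared_less order by metis
  then have np: "n < p"
    by simp
  \<comment> \<open>The image of \<open>\<rho>\<close> stands in for the quotient by
    \<open>K\<close>: its elements are matrices, so a central one can be fed to Schur's
    lemma.\<close>
  let ?H = "(GL n)\<lparr>carrier := \<rho> ` carrier G\<rparr>"
  interpret H: Group.group ?H
    by (rule rho.H.subgroup_imp_group[OF rho.img_is_subgroup])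
  interpret rho': group_hom G ?H \<rho>
    by unfold_locales (auto simp: hom_def)
  have "derived ?H (\<rho> ` carrier G) = \<rho> ` carrier G"
    using rho'.derived_img[of "carrier G"] perf unfolding perfect_def by simp
  then have perfH: "perfect ?H"
    unfolding perfect_def by simp
  have kerH: "kernel G ?H \<rho> = K"
    unfolding char_ker_kernel by (simp add: kernel_def)
  \<comment> \<open>The first isomorphism theorem transfers the index of \<open>K\<close> to the
    order of the image.\<close>
  have "bij_betw (\<lambda>X. the_elem (\<rho> ` X)) (carrier (G Mod K)) (carrier ?H)"
    using rho'.FactGroup_iso_set unfolding kerH iso_def by simp
  then have orderH: "Coset.order ?H = p * n"
    using bij_betw_same_card index by (fastforce simp: Coset.order_def FactGroup_def)
  have finH: "finite (carrier ?H)"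
    using fin by simp
  obtain X where X: "X \<in> carrier ?H" "H.ord X = p"
    and central: "\<And>Y. Y \<in> carrier ?H \<Longrightarrow> Y \<otimes>\<^bsub>?H\<^esub> X = X \<otimes>\<^bsub>?H\<^esub> Y"
    using H.perfect_imp_central_element[OF finH perfH p orderH np] by blast
  obtain g where g: "g \<in> carrier G" "X = \<rho> g"
    using X(1) by auto
  have "\<rho> h * \<rho> g = \<rho> g * \<rho> h" if "h \<in> carrier G" for h
    using central[of "\<rho> h"] that g by (simp add: GL_simps)
  then obtain c where c: "\<rho> g = c \<cdot>\<^sub>m 1\<^sub>m n"
    using schur[OF rho_carrier[OF g(1)]] by metis
  \<comment> \<open>The determinant is a linear character of a perfect group; on the scalar matrix
    \<open>\<rho> g\<close> it equals \<open>c ^ n\<close>.\<close>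
  have det: "det (\<rho> h) = 1" if "h \<in> carrier G" for h
  proof (rule perfect_imp_trivial_character[OF perf _ _ that])
    show "det (\<rho> (x \<otimes> y)) = det (\<rho> x) * det (\<rho> y)" if "x \<in> carrier G" "y \<in> carrier G" for x y
      using that by (simp only: rho_mult det_mult[OF rho_carrier rho_carrier])
    show "det (\<rho> \<one>) = 1"
      by (simp only: rho_one det_one)
  qed
  have cn: "c ^ n = 1"
    using det[OF g(1)] unfolding c by simp
  have "\<rho> (g [^] p) = \<one>\<^bsub>?H\<^esub>"
    using rho'.hom_nat_pow[OF g(1), of p] H.pow_ord_eq_1[OF X(1)] X(2) g(2) by simp
  then have "\<rho> (g [^] p) = 1\<^sub>m n"
    by (simp add: GL_simps)
  moreover have "\<rho> (g [^] k) = c ^ k \<cdot>\<^sub>m 1\<^sub>m n" for k :: nat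
  proof (induction k)
    case 0
    then show ?case by (simp only: nat_pow_0 rho_one) (auto intro: eq_matI)
  next
    case (Suc k)
    have "\<rho> (g [^] Suc k) = (c ^ k \<cdot>\<^sub>m 1\<^sub>m n) * (c \<cdot>\<^sub>m 1\<^sub>m n)"
      using g(1) Suc c by (simp only: nat_pow_Suc rho_mult nat_pow_closed)
    also have "\<dots> = c ^ Suc k \<cdot>\<^sub>m 1\<^sub>m n"
      by (intro eq_matI) (auto simp: mult_smult_distrib[of _ n n _ n] mult_smult_assoc_mat[of _ n n _ n])
    finally show ?case .
  qed
  \<comment> \<open>The entry at \<open>(0, 0)\<close> exists because the degree is
    positive.\<close>
  ultimately have "(c ^ p \<cdot>\<^sub>m 1\<^sub>m n) $$ (0, 0) = (1\<^sub>m n :: complex mat) $$ (0, 0)"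
    by simp
  then have cp: "c ^ p = 1"
    using n_pos by simp
  \<comment> \<open>From \<open>0 < n < p\<close>. With \<open>c ^ n = 1\<close> and
    \<open>c ^ p = 1\<close>, Bezout then gives \<open>c = 1\<close>, so \<open>X\<close> is trivial
    although it has order \<open>p\<close>.\<close>
  have "coprime n p"
    using p np n_pos by (metis coprime_commute nat_dvd_not_less prime_imp_coprime)
  then obtain x y where "n * x = p * y + 1"
    using bezout_nat[of n p] n_pos by auto
  then have "c ^ (n * x) = c ^ (p * y) * c"
    by simp
  then have "c = 1"
    by (simp add: power_mult cn cp)
  then have "X = \<one>\<^bsub>?H\<^esub>"
    using g c by (auto simp: GL_simps)
  then have "p = 1"
    using X(2) H.ord_id by metis
  then show False using p by simp
qed

section \<open>Linear characters and groups that are not perfect\<close>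

text \<open>View \<open>f\<close> as a representation by 1 by 1 matrices, irreducible because a line
  has only the two trivial subspaces. The restriction matches the extensional form of
  characters.\<close>

lemma (in Group.group) linear_character_in_Irr:
  fixes f :: "'a \<Rightarrow> complex"
  assumes mult: "\<And>x y. x \<in> carrier G \<Longrightarrow> y \<in> carrier G \<Longrightarrow> f (x \<otimes> y) = f x * f y"
    and one: "f \<one> = 1"
  shows "restrict f (carrier G) \<in> Irr G"
proof -
  define \<rho> where "\<rho> g = mat 1 1 (\<lambda>_. f g)" for g
  have \<rho>_mult: "\<rho> x * \<rho> y = mat 1 1 (\<lambda>_. f x * f y)" for x y
    by (auto simp: \<rho>_def scalar_prod_def intro!: eq_matI)
  have inv: "f x * f (inv x) = 1" if "x \<in> carrier G" for x
    using mult[of x "inv x"] that one by simp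
  have mat_1: "mat 1 1 (\<lambda>_. 1 :: complex) = 1\<^sub>m 1"
    by (auto intro: eq_matI)
  have "\<rho> x \<in> carrier (GL 1)" if "x \<in> carrier G" for x
  proof -
    have "\<rho> x * \<rho> (inv x) = 1\<^sub>m 1" "\<rho> (inv x) * \<rho> x = 1\<^sub>m 1"
      using inv[OF that] by (simp_all only: \<rho>_mult mult.commute[of "f (inv x)"] mat_1)
    moreover have "\<rho> y \<in> carrier_mat 1 1" for y
      by (simp add: \<rho>_def)
    ultimately show ?thesis
      unfolding GL_def units_of_def Units_def by (auto simp: ring_mat_simps)
  qed
  then have "representation G 1 \<rho>"
    unfolding representation_def hom_def
    by (auto simp: GL_simps \<rho>_mult mult) (simp add: \<rho>_def mult)
  moreover have "W = {0\<^sub>v 1} \<or> W = carrier_vec 1" if "invariant_subspace G 1 \<rho> W" for W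
  proof -
    have "submodule class_ring W (module_vec TYPE(complex) 1)"
      using that unfolding invariant_subspace_def VectorSpace.subspace_def by simp
    then have W: "W \<subseteq> carrier_vec 1" "0\<^sub>v 1 \<in> W" "\<And>c v. v \<in> W \<Longrightarrow> c \<cdot>\<^sub>v v \<in> W"
      unfolding submodule_def by (auto simp: module_vec_simps class_ring_simps)
    show ?thesis
    proof (cases "W = {0\<^sub>v 1}")
      case False
      then obtain w where w: "w \<in> W" "w \<noteq> 0\<^sub>v 1" using W(2) by blast
      then have "w \<in> carrier_vec 1" using W(1) by blast
      with w(2) have "w $ 0 \<noteq> 0" by (auto intro: eq_vecI)
      have "v \<in> W" if v: "v \<in> carrier_vec 1" for v
      proof -
        \<comment> \<open>Any nonzero vector spans the one-dimensional space.\<close>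
        have "v = (v $ 0 / w $ 0) \<cdot>\<^sub>v w"
          using v \<open>w \<in> carrier_vec 1\<close> \<open>w $ 0 \<noteq> 0\<close> by (intro eq_vecI) auto
        then show ?thesis using W(3)[OF w(1)] by metis
      qed
      then show ?thesis using W(1) by blast
    qed simp
  qed
  ultimately have "irreducible_representation G 1 \<rho>"
    unfolding irreducible_representation_def by simp
  moreover have "restrict f (carrier G) = character_of G \<rho>"
    by (auto simp: character_of_def mat_trace_def \<rho>_def)
  ultimately show ?thesis
    unfolding Irr_def by blast
qed

text \<open>Inflating a faithful linear character of a quotient of prime order gives a character of
  degree 1 with kernel exactly \<open>N\<close>, so its codegree is the index of
  \<open>N\<close>.\<close>

lemma (in Group.group) not_perfect_imp_ex_prime_cod:
  assumes "finite (carrier G)" "\<not> perfect G"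
  shows "\<exists>\<chi>\<in>Irr G. \<exists>p::nat. Factorial_Ring.prime p \<and> cod G \<chi> = of_nat p"
proof -
  obtain N where N: "N \<lhd> G" "Factorial_Ring.prime (card (rcosets N))"
    using ex_normal_subgroup_of_prime_index[OF assms] by blast
  interpret N: normal N G by (rule N(1))
  interpret F: Group.group "G Mod N" by (rule N.factorgroup_is_group)
  have carF: "carrier (G Mod N) = rcosets N" and oneF: "\<one>\<^bsub>G Mod N\<^esub> = N"
    by (simp_all add: FactGroup_def)
  have "Factorial_Ring.prime (Coset.order (G Mod N))"
    using N(2) by (simp add: Coset.order_def carF)
  from F.ex_faithful_linear_character[OF this] obtain f :: "'a set \<Rightarrow> complex"
    where mult: "\<forall>a\<in>carrier (G Mod N). \<forall>b\<in>carrier (G Mod N). f (a \<otimes>\<^bsub>G Mod N\<^esub> b) = f a * f b"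
      and faithful: "\<forall>a\<in>carrier (G Mod N). f a = 1 \<longleftrightarrow> a = \<one>\<^bsub>G Mod N\<^esub>"
    by (elim exE conjE)
  interpret h: group_hom G "G Mod N" "\<lambda>g. N #> g"
    by unfold_locales (rule N.r_coset_hom_Mod)
  let ?\<chi> = "restrict (\<lambda>g. f (N #> g)) (carrier G)"
  have one: "f (N #> \<one>) = 1"
    using bspec[OF faithful F.one_closed] by (simp only: h.hom_one)
  have "?\<chi> \<in> Irr G"
    by (rule linear_character_in_Irr) (use one h.hom_mult h.hom_closed mult in simp_all)
  moreover have "char_ker G ?\<chi> = N"
  proof -
    have "f (N #> g) = 1 \<longleftrightarrow> g \<in> N" if g: "g \<in> carrier G" for g
    proof -
      have "f (N #> g) = 1 \<longleftrightarrow> N #> g = N"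
        using faithful h.hom_closed[OF g] oneF by simp
      also have "\<dots> \<longleftrightarrow> g \<in> N"
        using N.rcos_const[OF is_group, of g] rcos_self[OF g N.subgroup_axioms] by metis
      finally show ?thesis .
    qed
    then show ?thesis
      using one N.subset by (auto simp: char_ker_def)
  qed
  then have "cod G ?\<chi> = of_nat (card (rcosets N))"
    using one by (simp add: cod_def)
  ultimately show ?thesis using N(2) by blast
qed

theorem theorem2p3:
  fixes G :: "('a, 'b) monoid_scheme"
  assumes "Group.group G" and "finite (carrier G)" and "carrier G \<noteq> {\<one>\<^bsub>G\<^esub>}"
  shows "perfect G \<longleftrightarrow> \<not> (\<exists>\<chi>\<in>Irr G. \<exists>p::nat. Factorial_Ring.prime p \<and> cod G \<chi> = of_nat p)"
proof -
  interpret Group.group G by (rule assms(1))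
  have "cod G \<chi> \<noteq> of_nat p" if perf: "perfect G" and irr: "\<chi> \<in> Irr G" and p: "Factorial_Ring.prime p" for \<chi> p
  proof -
    obtain n \<rho> where irred: "irreducible_representation G n \<rho>" and \<chi>: "\<chi> = character_of G \<rho>"
      using irr unfolding Irr_def by blast
    then interpret finite_group_irrep G n \<rho>
      by unfold_locales (use assms(2) in \<open>auto simp: irreducible_representation_def\<close>)
    show ?thesis
      unfolding \<chi> by (rule perfect_imp_cod_not_prime[OF perf p])
  qed
  then show ?thesis
    using not_perfect_imp_ex_prime_cod[OF assms(2)] by blast
qed

end
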